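(* Let $X$ be the space of all discrete multiple sets in $\mathbb{R}^k$ with the (extended) metric $\mathrm{dist}$. The almost periodic discrete multiple sets form a closed and complete subspace of $(X,\mathrm{dist})$; precisely, the set of almost periodic discrete multiple sets is closed in $(X,\mathrm{dist})$, and for every fixed discrete multiple set $D_0\in X$, the set of all almost periodic discrete multiple sets $D$ with $\mathrm{dist}(D,D_0)<\infty$ is a complete metric space under $\mathrm{dist}$.
   Context: A discrete multiple set $\{a_n\}_{n\in\mathbb{N}}$ in $\mathbb{R}^k$ is the value set, counted with multiplicity, of a sequence $(a_n)_{n=1}^\infty\subset\mathbb{R}^k$ having no finite limit points (equivalently, every bounded set contains $a_n$ for only finitely many indices $n$). Two sequences differing by a permutation of indices define the same discrete multiple set. For discrete multiple sets put $\mathrm{dist}(\{a_n\}_{n\in\mathbb{N}},\{b_n\}_{n\in\mathbb{N}})=\inf_{\sigma}\sup_{n\in\mathbb{N}}|a_n-b_{\sigma(n)}|\in[0,\infty]$, the infimum over all bijections $\sigma:\mathbb{N}\to\mathbb{N}$, where $|\cdot|$ is the Euclidean norm. This function satisfies all the axioms of a metric except finiteness. A vector $\tau\in\mathbb{R}^k$ is an $\varepsilon$-almost period of $\{a_n\}_{n\in\mathbb{N}}$ if $\mathrm{dist}(\{a_n\}_{n\in\mathbb{N}},\{a_n+\tau\}_{n\in\mathbb{N}})<\varepsilon$. A set $E\subset\mathbb{R}^k$ is relatively dense if there is $L<\infty$ such that every ball of radius $L$ in $\mathbb{R}^k$ meets $E$. A discrete multiple set is almost periodic if for each $\varepsilon>0$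 the set of its $\varepsilon$-almost periods is relatively dense in $\mathbb{R}^k$. *)

theory Defs
  imports "HOL-Analysis.Analysis"
begin

definition discrete_seq :: "(nat \<Rightarrow> real ^ 'k) \<Rightarrow> bool" where
  "discrete_seq a \<longleftrightarrow> (\<forall>B. bounded B \<longrightarrow> finite {n. a n \<in> B})"

definition perm_equiv :: "(nat \<Rightarrow> real ^ 'k) \<Rightarrow> (nat \<Rightarrow> real ^ 'k) \<Rightarrow> bool" where
  "perm_equiv a b \<longleftrightarrow>
     discrete_seq a \<and> discrete_seq b \<and> (\<exists>\<pi>. bij \<pi> \<and> (\<forall>n. b n = a (\<pi> n)))"

lemma discrete_seq_exists: "\<exists>a :: nat \<Rightarrow> real ^ 'k. discrete_seq a"
proof
  let ?a = "\<lambda>n. (\<chi> i. real n) :: real ^ 'k"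
  show "discrete_seq ?a"
    unfolding discrete_seq_def
  proof (intro allI impI)
    fix B :: "(real ^ 'k) set"
    assume "bounded B"
    then obtain R where R: "\<And>x. x \<in> B \<Longrightarrow> norm x \<le> R"
      by (auto simp: bounded_iff)
    have "n \<le> nat \<lceil>R\<rceil>" if "?a n \<in> B" for n
    proof -
      have "\<bar>?a n $ undefined\<bar> \<le> norm (?a n)"
        by (rule component_le_norm_cart)
      then have "real n \<le> R"
        using R[OF that] by simp
      then show ?thesis
        by linarith
    qed
    then have "{n. ?a n \<in> B} \<subseteq> {..nat \<lceil>R\<rceil>}"
      by auto
    then show "finite {n. ?a n \<in> B}"
      by (rule finite_subset) simp
  qed
qed

text \<open>The type of discrete multiple sets in the Euclidean space \<open>real ^ 'k\<close>: sequences
  without finite limit points, up to permutation of the indices.\<close>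

quotient_type (overloaded) 'k dms = "nat \<Rightarrow> real ^ ('k::finite)" / partial: perm_equiv
proof (rule part_equivpI)
  show "\<exists>a. perm_equiv a (a :: nat \<Rightarrow> real ^ 'k)"
    using discrete_seq_exists bij_id unfolding perm_equiv_def by fastforce
  show "symp (perm_equiv :: (nat \<Rightarrow> real ^ 'k) \<Rightarrow> _)"
  proof (rule sympI)
    fix a b :: "nat \<Rightarrow> real ^ 'k"
    assume "perm_equiv a b"
    then obtain \<pi> where d: "discrete_seq a" "discrete_seq b"
      and p: "bij \<pi>" "\<And>n. b n = a (\<pi> n)"
      unfolding perm_equiv_def by blast
    have "bij (inv \<pi>)" "\<And>n. a n = b (inv \<pi> n)"
      using p by (simp_all add: bij_imp_bij_inv bij_is_surj surj_f_inv_f)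
    then show "perm_equiv b a"
      using d unfolding perm_equiv_def by blast
  qed
  show "transp (perm_equiv :: (nat \<Rightarrow> real ^ 'k) \<Rightarrow> _)"
  proof (rule transpI)
    fix a b c :: "nat \<Rightarrow> real ^ 'k"
    assume ab: "perm_equiv a b" and bc: "perm_equiv b c"
    obtain \<pi> where p: "bij \<pi>" "\<And>n. b n = a (\<pi> n)"
      using ab unfolding perm_equiv_def by blast
    obtain \<rho> where r: "bij \<rho>" "\<And>n. c n = b (\<rho> n)"
      using bc unfolding perm_equiv_def by blast
    have "bij (\<pi> \<circ> \<rho>)" "\<And>n. c n = a ((\<pi> \<circ> \<rho>) n)"
      using p r by (simp_all add: bij_comp)
    then show "perm_equiv a c"
      using ab bc unfolding perm_equiv_def by blast
  qed
qed

definition seq_dist :: "(nat \<Rightarrow> real ^ 'k) \<Rightarrow> (nat \<Rightarrow> real ^ 'k) \<Rightarrow> ennreal" where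
  "seq_dist a b = (INF \<sigma>\<in>{\<sigma>. bij \<sigma>}. SUP n. ennreal (norm (a n - b (\<sigma> n))))"

lemma seq_dist_perm_le:
  assumes "bij \<pi>" "\<And>n. a' n = a (\<pi> n)" "bij \<rho>" "\<And>n. b' n = b (\<rho> n)"
  shows "seq_dist a b \<le> seq_dist a' b'"
  unfolding seq_dist_def
proof (rule INF_greatest)
  fix \<sigma> :: "nat \<Rightarrow> nat"
  assume "\<sigma> \<in> {\<sigma>. bij \<sigma>}"
  then have s: "bij \<sigma>"
    by simp
  let ?s = "\<rho> \<circ> \<sigma> \<circ> inv \<pi>"
  have "bij ?s"
    using s assms(1,3) by (intro bij_comp bij_imp_bij_inv)
  moreover have "(SUP n. ennreal (norm (a n - b (?s n)))) \<le> (SUP n. ennreal (norm (a' n - b' (\<sigma> n))))"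
  proof (rule SUP_least)
    fix n
    have "norm (a n - b (?s n)) = norm (a' (inv \<pi> n) - b' (\<sigma> (inv \<pi> n)))"
      using assms by (simp add: bij_is_surj surj_f_inv_f)
    then show "ennreal (norm (a n - b (?s n))) \<le> (SUP n. ennreal (norm (a' n - b' (\<sigma> n))))"
      by (metis (no_types, lifting) SUP_upper UNIV_I)
  qed
  ultimately show "(INF \<sigma>\<in>{\<sigma>. bij \<sigma>}. SUP n. ennreal (norm (a n - b (\<sigma> n))))
      \<le> (SUP n. ennreal (norm (a' n - b' (\<sigma> n))))"
    by (intro INF_lower2[of ?s]) auto
qed

lift_definition dms_dist :: "'k::finite dms \<Rightarrow> 'k dms \<Rightarrow> ennreal" is seq_dist
proof -
  fix a a' b b' :: "nat \<Rightarrow> real ^ 'k"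
  assume ab: "perm_equiv a a'" "perm_equiv b b'"
  then have "perm_equiv a' a" "perm_equiv b' b"
    using dms_equivp by (auto elim!: part_equivpE dest: sympD)
  with ab show "seq_dist a b = seq_dist a' b'"
    unfolding perm_equiv_def by (metis seq_dist_perm_le order_antisym)
qed

lift_definition dms_translate :: "real ^ 'k \<Rightarrow> 'k::finite dms \<Rightarrow> 'k dms" is
  "\<lambda>\<tau> a n. a n + \<tau>"
proof -
  fix \<tau> :: "real ^ 'k" and a b :: "nat \<Rightarrow> real ^ 'k"
  have shift: "discrete_seq (\<lambda>n. c n + \<tau>)" if "discrete_seq c" for c :: "nat \<Rightarrow> real ^ 'k"
    unfolding discrete_seq_def
  proof (intro allI impI)
    fix B :: "(real ^ 'k) set"
    assume "bounded B"
    then have "bounded ((\<lambda>x. - \<tau> + x) ` B)"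
      by (rule bounded_translation)
    then have "finite {n. c n \<in> (\<lambda>x. - \<tau> + x) ` B}"
      using that unfolding discrete_seq_def by blast
    moreover have "{n. c n + \<tau> \<in> B} \<subseteq> {n. c n \<in> (\<lambda>x. - \<tau> + x) ` B}"
      by (auto intro!: image_eqI[where x = "c _ + \<tau>"])
    ultimately show "finite {n. c n + \<tau> \<in> B}"
      by (rule rev_finite_subset)
  qed
  assume "perm_equiv a b"
  then show "perm_equiv (\<lambda>n. a n + \<tau>) (\<lambda>n. b n + \<tau>)"
    unfolding perm_equiv_def using shift by metis
qed

definition almost_period :: "real \<Rightarrow> 'k::finite dms \<Rightarrow> real ^ 'k \<Rightarrow> bool" where
  "almost_period \<epsilon> D \<tau> \<longleftrightarrow> dms_dist D (dms_translate \<tau> D) < ennreal \<epsilon>"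

definition relatively_dense :: "(real ^ 'k) set \<Rightarrow> bool" where
  "relatively_dense E \<longleftrightarrow> (\<exists>L. \<forall>x. ball x L \<inter> E \<noteq> {})"

definition almost_periodic :: "'k::finite dms \<Rightarrow> bool" where
  "almost_periodic D \<longleftrightarrow> (\<forall>\<epsilon>>0. relatively_dense {\<tau>. almost_period \<epsilon> D \<tau>})"

text \<open>The topology of the extended metric \<^const>\<open>dms_dist\<close>; its points are all discrete
  multiple sets.\<close>

definition dms_topology :: "'k::finite dms topology" where
  "dms_topology = topology (\<lambda>U. \<forall>D\<in>U. \<exists>r>0. \<forall>D'. dms_dist D D' < ennreal r \<longrightarrow> D' \<in> U)"

lemma openin_dms_topology:
  "openin dms_topology U \<longleftrightarrow> (\<forall>D\<in>U. \<exists>r>0. \<forall>D'. dms_dist D D' < ennreal r \<longrightarrow> D' \<in> U)"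
proof -
  let ?open = "\<lambda>U. \<forall>D\<in>U. \<exists>r>0. \<forall>D'. dms_dist D D' < ennreal r \<longrightarrow> D' \<in> U"
  have "?open (S \<inter> T)" if S: "?open S" and T: "?open T" for S T
  proof
    fix D assume "D \<in> S \<inter> T"
    then obtain r s where "r > 0" "\<And>D'. dms_dist D D' < ennreal r \<Longrightarrow> D' \<in> S"
        "s > 0" "\<And>D'. dms_dist D D' < ennreal s \<Longrightarrow> D' \<in> T"
      using S T by (metis IntE)
    moreover have "ennreal (min r s) \<le> ennreal r" "ennreal (min r s) \<le> ennreal s"
      by (simp_all add: ennreal_leI)
    ultimately show "\<exists>r>0. \<forall>D'. dms_dist D D' < ennreal r \<longrightarrow> D' \<in> S \<inter> T"
      by (metis IntI less_le_trans min_less_iff_conj)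
  qed
  moreover have "?open (\<Union>K)" if "\<forall>U\<in>K. ?open U" for K
    using that by (meson UnionE UnionI)
  ultimately have "istopology ?open"
    unfolding istopology_def by blast
  then show ?thesis
    unfolding dms_topology_def by (subst topology_inverse') simp_all
qed

end

theory Submission
  imports Defs
begin

text \<open>If two discrete multiple sets are at distance below \<open>\<epsilon>\<close>, then the second can be renumbered
  so that corresponding terms are closer than \<open>\<epsilon>\<close> (\<open>aligned_representative\<close>), and termwise
  bounds conversely bound the distance. Thereby the metric properties and the invariance under translation
  are inherited from the Euclidean norm. The exception is that distance zero forces equality: instead
  of looking for one bijection that attains the infimum, one compares the multiplicities of each
  point separately, where a sufficiently small displacement suffices because the points with other
  values keep a positive distance from it (\<open>dms_mult_le_if_dist_0\<close>).

  Almost periodicity is closed because an \<open>\<epsilon>/3\<close>-almost period of \<open>E\<close> is an \<open>\<epsilon>\<close>-almost period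
  of every \<open>D\<close> within distance \<open>\<epsilon>/3\<close> of \<open>E\<close> (\<open>almost_period_transfer\<close>).

  For completeness, a Cauchy sequence has a subsequence whose consecutive distances are below
  \<open>(1/2)\<^sup>j\<close>. Aligning each of its members with the previous one yields sequences that converge
  uniformly in the index (\<open>summable_dms_sequence_converges\<close>). Their limit represents the limit of
  the whole Cauchy sequence; it is almost periodic by closedness, and it stays at finite distance
  from \<open>D\<^sub>0\<close> by the triangle inequality.\<close>

section \<open>Aligned representatives\<close>

lemma perm_equiv_refl: "discrete_seq a \<Longrightarrow> perm_equiv a a"
  unfolding perm_equiv_def using bij_id by (metis id_apply)

lemma dms_cases:
  obtains a where "discrete_seq a" "D = abs_dms a"
  by (metis Quotient3_abs_rep Quotient3_dms Quotient3_rep_reflp perm_equiv_def)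

lemma abs_dms_permute:
  assumes "discrete_seq b" "bij \<pi>"
  shows "discrete_seq (b \<circ> \<pi>)" "abs_dms (b \<circ> \<pi>) = abs_dms b"
proof -
  show d: "discrete_seq (b \<circ> \<pi>)"
    unfolding discrete_seq_def
  proof (intro allI impI)
    fix B :: "(real ^ 'a) set"
    assume "bounded B"
    then have "finite {n. b n \<in> B}"
      using assms(1) by (simp add: discrete_seq_def)
    then have "finite (\<pi> -` {n. b n \<in> B})"
      by (rule finite_vimageI) (rule bij_is_inj[OF assms(2)])
    then show "finite {n. (b \<circ> \<pi>) n \<in> B}"
      by (simp add: vimage_def)
  qed
  have "perm_equiv b (b \<circ> \<pi>)"
    using assms d by (auto simp: perm_equiv_def)
  then show "abs_dms (b \<circ> \<pi>) = abs_dms b"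
    by (metis Quotient3_dms Quotient3_rel)
qed

text \<open>The infimum over bijections is absorbed once and for all by renumbering the second
  sequence. With the converse bound \<open>dms_dist_le_termwise\<close>, estimates of the distance
  become termwise estimates between sequences.\<close>

lemma aligned_representative:
  assumes "discrete_seq a" "dms_dist (abs_dms a) E < ennreal \<epsilon>"
  obtains b where "discrete_seq b" "E = abs_dms b" "\<And>n. norm (a n - b n) < \<epsilon>"
proof -
  obtain c where c: "discrete_seq c" "E = abs_dms c"
    by (rule dms_cases)
  have "seq_dist a c < ennreal \<epsilon>"
    using assms c by (simp add: dms_dist.abs_eq perm_equiv_refl)
  then obtain \<sigma> where \<sigma>: "bij \<sigma>" "(SUP n. ennreal (norm (a n - c (\<sigma> n)))) < ennreal \<epsilon>"
    unfolding seq_dist_def INF_less_iff by auto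
  have "norm (a n - (c \<circ> \<sigma>) n) < \<epsilon>" for n
  proof -
    have "ennreal (norm (a n - c (\<sigma> n))) < ennreal \<epsilon>"
      using \<sigma>(2) by (meson SUP_lessD UNIV_I)
    then show ?thesis
      by (simp add: ennreal_less_iff)
  qed
  with that show thesis
    using abs_dms_permute[OF c(1) \<sigma>(1)] c(2) by metis
qed

lemma dms_dist_le_termwise:
  assumes "discrete_seq a" "discrete_seq b" "\<And>n. norm (a n - b n) \<le> \<epsilon>"
  shows "dms_dist (abs_dms a) (abs_dms b) \<le> ennreal \<epsilon>"
proof -
  have "id \<in> {\<sigma> :: nat \<Rightarrow> nat. bij \<sigma>}"
    using bij_id by blast
  then have "seq_dist a b \<le> (SUP n. ennreal (norm (a n - b (id n))))"
    unfolding seq_dist_def by (rule INF_lower)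
  also have "\<dots> \<le> ennreal \<epsilon>"
    using assms(3) by (intro SUP_least) (simp add: ennreal_leI)
  finally show ?thesis
    using assms by (simp add: dms_dist.abs_eq perm_equiv_refl)
qed

section \<open>The extended metric\<close>

lemma ennreal_le_by_upper_bounds:
  fixes x y :: ennreal
  assumes "\<And>\<epsilon>. x < ennreal \<epsilon> \<Longrightarrow> y \<le> ennreal \<epsilon>"
  shows "y \<le> x"
proof (rule dense_ge)
  fix z assume "x < z"
  then show "y \<le> z"
    using assms by (cases z) auto
qed

lemma dms_dist_refl: "dms_dist D D = 0"
proof -
  obtain a where "discrete_seq a" "D = abs_dms a"
    by (rule dms_cases)
  then show ?thesis
    using dms_dist_le_termwise[of a a 0] by simp
qed

lemma dms_dist_commute: "dms_dist D E = dms_dist E D"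
proof -
  have "dms_dist E D \<le> dms_dist D E" for D E :: "'a dms"
  proof (rule ennreal_le_by_upper_bounds)
    fix \<epsilon> assume *: "dms_dist D E < ennreal \<epsilon>"
    obtain a where a: "discrete_seq a" "D = abs_dms a"
      by (rule dms_cases)
    obtain b where b: "discrete_seq b" "E = abs_dms b" "\<And>n. norm (a n - b n) < \<epsilon>"
      using aligned_representative[of a E \<epsilon>] a * by metis
    then show "dms_dist E D \<le> ennreal \<epsilon>"
      using a by (auto intro!: dms_dist_le_termwise simp: norm_minus_commute less_imp_le)
  qed
  then show ?thesis
    by (simp add: order_antisym)
qed

lemma dms_dist_triangle: "dms_dist D F \<le> dms_dist D E + dms_dist E F"
proof -
  have bound: "dms_dist D F \<le> ennreal p + ennreal q"
    if p: "dms_dist D E < ennreal p" and q: "dms_dist E F < ennreal q" for p q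
  proof -
    obtain a where a: "discrete_seq a" "D = abs_dms a"
      by (rule dms_cases)
    obtain b where b: "discrete_seq b" "E = abs_dms b" "\<And>n. norm (a n - b n) < p"
      using aligned_representative[of a E p] a p by metis
    obtain c where c: "discrete_seq c" "F = abs_dms c" "\<And>n. norm (b n - c n) < q"
      using aligned_representative[of b F q] b q by metis
    have "norm (a n - c n) \<le> p + q" for n
      using norm_triangle_ineq[of "a n - b n" "b n - c n"] b(3)[of n] c(3)[of n] by simp
    moreover have "0 \<le> p" "0 \<le> q"
      using b(3)[of 0] c(3)[of 0] norm_ge_zero le_less_trans less_imp_le by blast+
    ultimately show ?thesis
      using dms_dist_le_termwise[of a c "p + q"] a c by simp
  qed
  show ?thesis
  proof (cases "dms_dist D E = top \<or> dms_dist E F = top")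
    case False
    then obtain x y where xy: "dms_dist D E = ennreal x" "0 \<le> x" "dms_dist E F = ennreal y" "0 \<le> y"
      by (metis ennreal_cases)
    have "dms_dist D F \<le> ennreal (x + y) + ennreal e" if "e > 0" for e
    proof -
      have "dms_dist D F \<le> ennreal (x + e / 2) + ennreal (y + e / 2)"
        using xy that by (intro bound) (simp_all add: ennreal_less_iff)
      also have "\<dots> = ennreal (x + y) + ennreal e"
        using xy that by (simp flip: ennreal_plus)
      finally show ?thesis .
    qed
    then have "dms_dist D F \<le> ennreal (x + y)"
      by (rule ennreal_le_epsilon)
    then show ?thesis
      using xy by simp
  qed auto
qed

lemma dms_dist_triangle_less:
  assumes "dms_dist D E < ennreal p" "dms_dist E F < ennreal q"
  shows "dms_dist D F < ennreal (p + q)"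
  using dms_dist_triangle add_mono_ennreal[OF assms] by (rule le_less_trans)

section \<open>Distance zero\<close>

lift_definition dms_mult :: "'k::finite dms \<Rightarrow> real ^ 'k \<Rightarrow> nat" is
  "\<lambda>a x. card {n. a n = x}"
proof -
  fix a b :: "nat \<Rightarrow> real ^ 'k"
  assume "perm_equiv a b"
  then obtain \<pi> where \<pi>: "bij \<pi>" "\<And>n. b n = a (\<pi> n)"
    unfolding perm_equiv_def by blast
  have "card {n. a n = x} = card {n. b n = x}" for x
  proof -
    have "{n. b n = x} = \<pi> -` {n. a n = x}"
      using \<pi>(2) by auto
    then show ?thesis
      using \<pi>(1) by (metis bij_is_inj bij_is_surj card_vimage_inj top_greatest)
  qed
  then show "(\<lambda>x. card {n. a n = x}) = (\<lambda>x. card {n. b n = x})"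
    by blast
qed

lemma finite_fibre:
  assumes "discrete_seq a"
  shows "finite {n. a n = x}"
proof -
  have "finite {n. a n \<in> {x}}"
    using assms[unfolded discrete_seq_def, rule_format, of "{x}"] by simp
  then show ?thesis
    by simp
qed

text \<open>Fibres over the same point are finite of equal cardinality, so bijections between them
  exist and glue to a permutation of the indices.\<close>

lemma dms_eq_iff_mult: "D = E \<longleftrightarrow> dms_mult D = dms_mult E"
proof
  assume eq: "dms_mult D = dms_mult E"
  obtain a where a: "discrete_seq a" "D = abs_dms a"
    by (rule dms_cases)
  obtain b where b: "discrete_seq b" "E = abs_dms b"
    by (rule dms_cases)
  have "card {n. b n = x} = card {n. a n = x}" for x
    using eq a b by (metis dms_mult.abs_eq perm_equiv_refl)
  then have "\<exists>f. bij_betw f {n. b n = x} {n. a n = x}" for x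
    using finite_fibre[OF a(1)] finite_fibre[OF b(1)] by (metis finite_same_card_bij)
  then obtain f where f: "\<And>x. bij_betw (f x) {n. b n = x} {n. a n = x}"
    by metis
  define \<pi> where "\<pi> n = f (b n) n" for n
  have a\<pi>: "a (\<pi> n) = b n" for n
    using bij_betw_apply[OF f[of "b n"]] by (simp add: \<pi>_def)
  have "inj \<pi>"
  proof (rule injI)
    fix m n assume "\<pi> m = \<pi> n"
    moreover from this have "b m = b n"
      by (metis a\<pi>)
    ultimately show "m = n"
      using bij_betw_imp_inj_on[OF f[of "b n"]] by (auto simp: \<pi>_def dest: inj_onD)
  qed
  moreover have "surj \<pi>"
  proof (rule surjI)
    fix m
    have "m \<in> f (a m) ` {n. b n = a m}"
      using bij_betw_imp_surj_on[OF f[of "a m"]] by simp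
    then obtain n where "m = f (a m) n" "b n = a m"
      by blast
    then have "\<exists>n. \<pi> n = m"
      by (metis \<pi>_def)
    then show "\<pi> (SOME n. \<pi> n = m) = m"
      by (rule someI_ex)
  qed
  ultimately have "bij \<pi>"
    by (simp add: bij_def)
  then have "abs_dms (a \<circ> \<pi>) = abs_dms a"
    by (rule abs_dms_permute(2)[OF a(1)])
  moreover have "a \<circ> \<pi> = b"
    using a\<pi> by auto
  ultimately show "D = E"
    using a b by simp
qed simp

lemma discrete_seq_isolated:
  assumes "discrete_seq b"
  obtains r where "r > 0" "\<And>n. norm (x - b n) < r \<Longrightarrow> b n = x"
proof -
  have "finite {n. b n \<in> cball x 1}"
    using assms[unfolded discrete_seq_def, rule_format, OF bounded_cball] .
  then have "finite (b ` {n. b n \<in> cball x 1})"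
    by simp
  then obtain d where d: "d > 0" "\<And>y. y \<in> b ` {n. b n \<in> cball x 1} \<Longrightarrow> y \<noteq> x \<Longrightarrow> d \<le> dist x y"
    using finite_set_avoid by metis
  show thesis
  proof (rule that)
    show "min d 1 > 0"
      using d by simp
    fix n assume "norm (x - b n) < min d 1"
    then have "dist x (b n) < d" "b n \<in> cball x 1"
      by (simp_all add: dist_norm)
    then show "b n = x"
      using d(2)[of "b n"] by fastforce
  qed
qed

text \<open>Around each point \<open>x\<close> there is a ball in which \<open>E\<close> has no point other than \<open>x\<close>; a matching
  with displacements smaller than its radius sends every copy of \<open>x\<close> in \<open>D\<close> to a copy of \<open>x\<close>
  in \<open>E\<close>. The matching may depend on \<open>x\<close>.\<close>

lemma dms_mult_le_if_dist_0:
  assumes "dms_dist D E = 0"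
  shows "dms_mult D x \<le> dms_mult E x"
proof -
  obtain b where b: "discrete_seq b" "E = abs_dms b"
    by (rule dms_cases)
  obtain r where r: "r > 0" "\<And>n. norm (x - b n) < r \<Longrightarrow> b n = x"
    using discrete_seq_isolated[OF b(1)] by metis
  obtain a where a: "discrete_seq a" "D = abs_dms a" "\<And>n. norm (b n - a n) < r"
    using aligned_representative[OF b(1), of D r] assms b r(1) by (metis dms_dist_commute ennreal_less_zero_iff)
  have "{n. a n = x} \<subseteq> {n. b n = x}"
    using a(3) r(2) by (auto simp: norm_minus_commute)
  then have "card {n. a n = x} \<le> card {n. b n = x}"
    by (rule card_mono[OF finite_fibre[OF b(1)]])
  then show ?thesis
    using a b by (simp add: dms_mult.abs_eq perm_equiv_refl)
qed

lemma dms_dist_eq_0_iff: "dms_dist D E = 0 \<longleftrightarrow> D = E"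
proof
  assume "dms_dist D E = 0"
  then have "dms_mult D x = dms_mult E x" for x
    by (intro order_antisym dms_mult_le_if_dist_0) (simp_all add: dms_dist_commute)
  then show "D = E"
    by (auto simp: dms_eq_iff_mult)
qed (simp add: dms_dist_refl)

section \<open>Almost periodicity passes to limits\<close>

lemma discrete_seq_perturb:
  assumes "discrete_seq a" "\<And>n. norm (a n - b n) \<le> c"
  shows "discrete_seq b"
  unfolding discrete_seq_def
proof (intro allI impI)
  fix B :: "(real ^ 'a) set"
  assume "bounded B"
  then obtain R where R: "\<And>x. x \<in> B \<Longrightarrow> norm x \<le> R"
    by (auto simp: bounded_iff)
  have "norm (a n) \<le> R + c" if "b n \<in> B" for n
    using norm_triangle_ineq[of "b n" "a n - b n"] R[OF that] assms(2)[of n] by simp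
  then have "{n. b n \<in> B} \<subseteq> {n. a n \<in> cball 0 (R + c)}"
    by auto
  moreover have "finite {n. a n \<in> cball 0 (R + c)}"
    using assms(1)[unfolded discrete_seq_def, rule_format, OF bounded_cball] .
  ultimately show "finite {n. b n \<in> B}"
    by (rule finite_subset)
qed

lemma dms_dist_translate_le:
  "dms_dist (dms_translate \<tau> D) (dms_translate \<tau> E) \<le> dms_dist D E"
proof (rule ennreal_le_by_upper_bounds)
  fix \<epsilon> assume *: "dms_dist D E < ennreal \<epsilon>"
  obtain a where a: "discrete_seq a" "D = abs_dms a"
    by (rule dms_cases)
  obtain b where b: "discrete_seq b" "E = abs_dms b" "\<And>n. norm (a n - b n) < \<epsilon>"
    using aligned_representative[of a E \<epsilon>] a * by metis
  have shift: "discrete_seq (\<lambda>n. c n + \<tau>)" if "discrete_seq c" for c :: "nat \<Rightarrow> real ^ 'a"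
    by (rule discrete_seq_perturb[OF that, of _ "norm \<tau>"]) simp
  show "dms_dist (dms_translate \<tau> D) (dms_translate \<tau> E) \<le> ennreal \<epsilon>"
    using a b dms_dist_le_termwise[OF shift shift, of a b \<epsilon>]
    by (simp add: dms_translate.abs_eq perm_equiv_refl less_imp_le)
qed

text \<open>Translating both sets does not increase their distance, so passing from \<open>D\<close> to \<open>D + \<tau>\<close> by way of
  \<open>E\<close> and \<open>E + \<tau>\<close> costs the distance of \<open>D\<close> and \<open>E\<close> only twice.\<close>

lemma almost_period_transfer:
  assumes "dms_dist D E < ennreal (\<epsilon> / 3)" "almost_period (\<epsilon> / 3) E \<tau>"
  shows "almost_period \<epsilon> D \<tau>"
proof -
  have "dms_dist (dms_translate \<tau> E) (dms_translate \<tau> D) < ennreal (\<epsilon> / 3)"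
    using dms_dist_translate_le[of \<tau> E D] assms(1) by (simp add: dms_dist_commute)
  moreover have "dms_dist D (dms_translate \<tau> E) < ennreal (\<epsilon> / 3 + \<epsilon> / 3)"
    using assms unfolding almost_period_def by (rule dms_dist_triangle_less)
  ultimately have "dms_dist D (dms_translate \<tau> D) < ennreal (\<epsilon> / 3 + \<epsilon> / 3 + \<epsilon> / 3)"
    using dms_dist_triangle_less by blast
  then show ?thesis
    by (simp add: almost_period_def)
qed

lemma relatively_dense_mono: "relatively_dense A \<Longrightarrow> A \<subseteq> B \<Longrightarrow> relatively_dense B"
  unfolding relatively_dense_def by (metis Int_mono order_refl subset_empty)

lemma almost_periodic_limit:
  assumes "\<And>r. r > 0 \<Longrightarrow> \<exists>E. almost_periodic E \<and> dms_dist D E < ennreal r"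
  shows "almost_periodic D"
  unfolding almost_periodic_def
proof (intro allI impI)
  fix \<epsilon> :: real
  assume "\<epsilon> > 0"
  then obtain E where E: "almost_periodic E" "dms_dist D E < ennreal (\<epsilon> / 3)"
    using assms[of "\<epsilon> / 3"] by auto
  have "relatively_dense {\<tau>. almost_period (\<epsilon> / 3) E \<tau>}"
    using E(1) \<open>\<epsilon> > 0\<close> by (simp add: almost_periodic_def)
  then show "relatively_dense {\<tau>. almost_period \<epsilon> D \<tau>}"
    by (rule relatively_dense_mono) (use almost_period_transfer[OF E(2)] in blast)
qed

lemma closedin_almost_periodic: "closedin dms_topology {D. almost_periodic D}"
proof -
  have "openin dms_topology (- {D. almost_periodic D})"
    unfolding openin_dms_topology using almost_periodic_limit by blast
  moreover have "topspace dms_topology = (UNIV :: 'a dms set)"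
  proof -
    have "openin dms_topology (UNIV :: 'a dms set)"
      unfolding openin_dms_topology using zero_less_one by blast
    then show ?thesis
      using openin_subset by blast
  qed
  ultimately show ?thesis
    by (simp add: closedin_def Compl_eq_Diff_UNIV)
qed

section \<open>Completeness\<close>

text \<open>The matchings between consecutive members are composed, so that all members are
  enumerated compatibly; then the limit can be taken index by index. The limit sequence is
  discrete because it stays within bounded distance of the first member.\<close>

lemma summable_dms_sequence_converges:
  fixes D :: "nat \<Rightarrow> 'k::finite dms"
  assumes "\<And>j. dms_dist (D j) (D (Suc j)) < ennreal ((1/2) ^ j)"
  obtains E where "\<And>j. dms_dist (D j) E \<le> ennreal (2 * (1/2) ^ j)"
proof -
  have "\<exists>A. \<forall>j. (discrete_seq (A j) \<and> D j = abs_dms (A j)) \<and>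
      (\<forall>n. norm (A j n - A (Suc j) n) < (1/2) ^ j)"
  proof (rule dependent_nat_choice)
    show "\<exists>a. discrete_seq a \<and> D 0 = abs_dms a"
      by (metis dms_cases)
    fix a j
    assume "discrete_seq a \<and> D j = abs_dms a"
    then show "\<exists>b. (discrete_seq b \<and> D (Suc j) = abs_dms b) \<and> (\<forall>n. norm (a n - b n) < (1/2) ^ j)"
      using aligned_representative[of a "D (Suc j)" "(1/2) ^ j"] assms[of j] by metis
  qed
  then obtain A where A: "\<And>j. discrete_seq (A j)" "\<And>j. D j = abs_dms (A j)"
      "\<And>j n. norm (A j n - A (Suc j) n) < (1/2) ^ j"
    by blast
  have telescope: "norm (A j n - A (j + i) n) \<le> 2 * (1/2) ^ j - 2 * (1/2) ^ (j + i)" for i j n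
  proof (induction i)
    case (Suc i)
    have "norm (A j n - A (j + Suc i) n)
        \<le> norm (A j n - A (j + i) n) + norm (A (j + i) n - A (Suc (j + i)) n)"
      using norm_triangle_ineq[of "A j n - A (j + i) n" "A (j + i) n - A (Suc (j + i)) n"] by simp
    also have "\<dots> \<le> 2 * (1/2) ^ j - 2 * (1/2) ^ (j + i) + (1/2) ^ (j + i)"
      using Suc A(3)[of "j + i" n] by linarith
    finally show ?case
      by simp
  qed simp
  have close: "norm (A j n - A m n) \<le> 2 * (1/2) ^ j" if "j \<le> m" for j m n
  proof -
    have "norm (A j n - A m n) \<le> 2 * (1/2) ^ j - 2 * (1/2) ^ m"
      using telescope[of j n "m - j"] that by simp
    moreover have "(0::real) \<le> 2 * (1/2) ^ m"
      by simp
    ultimately show ?thesis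
      by linarith
  qed
  have null: "(\<lambda>j. 2 * (1/2) ^ j :: real) \<longlonglongrightarrow> 0"
    by (intro tendsto_mult_right_zero LIMSEQ_power_zero) simp
  have "convergent (\<lambda>j. A j n)" for n
  proof (rule Cauchy_convergent, rule CauchyI')
    fix e :: real
    assume "e > 0"
    then have "\<forall>\<^sub>F j in sequentially. 2 * (1/2) ^ j < e"
      using order_tendstoD(2)[OF null] by blast
    then obtain N where "\<And>j. j \<ge> N \<Longrightarrow> 2 * (1/2) ^ j < e"
      by (auto simp: eventually_sequentially)
    then have "dist (A j n) (A m n) < e" if "j \<ge> N" "m > j" for j m
      using close[of j m n] that by (metis dist_norm le_less_trans less_imp_le)
    then show "\<exists>N. \<forall>j\<ge>N. \<forall>m>j. dist (A j n) (A m n) < e"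
      by blast
  qed
  then obtain L where L: "\<And>n. (\<lambda>j. A j n) \<longlonglongrightarrow> L n"
    unfolding convergent_def by metis
  have AL: "norm (A j n - L n) \<le> 2 * (1/2) ^ j" for j n
  proof (rule tendsto_upperbound)
    show "(\<lambda>m. norm (A j n - A m n)) \<longlonglongrightarrow> norm (A j n - L n)"
      by (intro tendsto_intros L)
    show "\<forall>\<^sub>F m in sequentially. norm (A j n - A m n) \<le> 2 * (1/2) ^ j"
      using eventually_ge_at_top[of j] by eventually_elim (rule close)
  qed simp
  have "discrete_seq L"
    using A(1) AL by (rule discrete_seq_perturb)
  then have "dms_dist (D j) (abs_dms L) \<le> ennreal (2 * (1/2) ^ j)" for j
    unfolding A(2) using AL by (intro dms_dist_le_termwise A(1))
  then show thesis
    by (rule that)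
qed

lemma dms_Cauchy_converges:
  fixes D :: "nat \<Rightarrow> 'k::finite dms"
  assumes cauchy: "\<And>r. r > 0 \<Longrightarrow> \<exists>N. \<forall>m\<ge>N. \<forall>n\<ge>N. dms_dist (D m) (D n) < ennreal r"
  obtains E where "\<And>r. r > 0 \<Longrightarrow> \<forall>\<^sub>F n in sequentially. dms_dist (D n) E < ennreal r"
proof -
  have "\<exists>N. \<forall>m\<ge>N. \<forall>n\<ge>N. dms_dist (D m) (D n) < ennreal ((1/2) ^ j)" for j :: nat
    by (rule cauchy) simp
  then obtain N where N:
    "\<And>j m n. m \<ge> N j \<Longrightarrow> n \<ge> N j \<Longrightarrow> dms_dist (D m) (D n) < ennreal ((1/2) ^ j)"
    by metis
  (* Partial sums turn N into a monotone choice of indices. *)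
  define K where "K j = (\<Sum>i\<le>j. N i)" for j
  have K: "K j \<ge> N j" "K (Suc j) \<ge> N j" for j
    by (auto simp: K_def intro: order_trans[OF member_le_sum[of j "{..j}" N]])
  obtain E where E: "\<And>j. dms_dist (D (K j)) E \<le> ennreal (2 * (1/2) ^ j)"
    using summable_dms_sequence_converges[of "\<lambda>j. D (K j)"] N K by metis
  show thesis
  proof (rule that[of E])
    fix r :: real
    assume "r > 0"
    have "(\<lambda>j. 3 * (1/2) ^ j :: real) \<longlonglongrightarrow> 0"
      by (intro tendsto_mult_right_zero LIMSEQ_power_zero) simp
    then have "\<forall>\<^sub>F j in sequentially. 3 * (1/2) ^ j < r"
      using \<open>r > 0\<close> by (rule order_tendstoD)
    then obtain j where j: "3 * (1/2) ^ j < r"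
      by (auto simp: eventually_sequentially)
    have "dms_dist (D n) E < ennreal r" if "n \<ge> N j" for n
    proof -
      have "dms_dist (D n) E \<le> dms_dist (D n) (D (K j)) + dms_dist (D (K j)) E"
        by (rule dms_dist_triangle)
      also have "\<dots> \<le> ennreal ((1/2) ^ j) + ennreal (2 * (1/2) ^ j)"
        using N[OF that K(1)] E by (intro add_mono) (auto intro: less_imp_le)
      also have "\<dots> = ennreal (3 * (1/2) ^ j)"
        by (simp flip: ennreal_plus)
      also have "\<dots> < ennreal r"
        using j by (simp add: ennreal_less_iff)
      finally show ?thesis .
    qed
    then show "\<forall>\<^sub>F n in sequentially. dms_dist (D n) E < ennreal r"
      by (auto simp: eventually_sequentially)
  qed
qed

lemma enn2real_dms_dist_less_iff:
  assumes "dms_dist D E < \<infinity>" "r > 0"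
  shows "enn2real (dms_dist D E) < r \<longleftrightarrow> dms_dist D E < ennreal r"
  using assms by (cases "dms_dist D E") (auto simp: ennreal_less_iff)

theorem mainTheorem2:
  shows "closedin dms_topology {D :: 'k::finite dms. almost_periodic D} \<and>
    (\<forall>D\<^sub>0 :: 'k dms.
      let M = {D. almost_periodic D \<and> dms_dist D D\<^sub>0 < \<infinity>};
          d = (\<lambda>D E. enn2real (dms_dist D E))
      in (\<forall>D\<in>M. \<forall>E\<in>M. dms_dist D E < \<infinity>) \<and>
         Metric_space M d \<and> Metric_space.mcomplete M d)"
  unfolding Let_def
proof (intro conjI allI)
  show "closedin dms_topology {D :: 'k dms. almost_periodic D}"
    by (rule closedin_almost_periodic)
next
  fix D\<^sub>0 :: "'k dms"
  let ?M = "{D. almost_periodic D \<and> dms_dist D D\<^sub>0 < \<infinity>}"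
  let ?d = "\<lambda>D E :: 'k dms. enn2real (dms_dist D E)"
  have finite_trans: "dms_dist D F < \<infinity>"
    if "dms_dist D E < \<infinity>" "dms_dist E F < \<infinity>" for D E F :: "'k dms"
    using le_less_trans[OF dms_dist_triangle[of D F E]] that by simp
  show fin: "\<forall>D\<in>?M. \<forall>E\<in>?M. dms_dist D E < \<infinity>"
  proof (intro ballI)
    fix D E assume "D \<in> ?M" "E \<in> ?M"
    then show "dms_dist D E < \<infinity>"
      using finite_trans[of D D\<^sub>0 E] by (simp add: dms_dist_commute[of D\<^sub>0 E])
  qed
  show metric: "Metric_space ?M ?d"
  proof
    fix D E F :: "'k dms"
    show "0 \<le> ?d D E" "?d D E = ?d E D"
      by (simp_all add: dms_dist_commute)
    assume D: "D \<in> ?M" and E: "E \<in> ?M"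
    then have DE: "dms_dist D E < top"
      using fin by fastforce
    then show "?d D E = 0 \<longleftrightarrow> D = E"
      by (auto simp: enn2real_eq_0_iff dms_dist_eq_0_iff)
    assume "F \<in> ?M"
    then have EF: "dms_dist E F < top"
      using fin E by fastforce
    have "?d D F \<le> enn2real (dms_dist D E + dms_dist E F)"
      using DE EF by (intro enn2real_mono dms_dist_triangle) simp
    also have "\<dots> = ?d D E + ?d E F"
      using DE EF by (rule enn2real_plus)
    finally show "?d D F \<le> ?d D E + ?d E F" .
  qed
  interpret Metric_space ?M ?d
    by (rule metric)
  show mcomplete
    unfolding mcomplete_def
  proof (intro allI impI)
    fix D
    assume MC: "MCauchy D"
    then have DM: "D n \<in> ?M" for n
      unfolding MCauchy_def by blast
    have fin_D: "dms_dist (D m) (D n) < \<infinity>" for m n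
      using fin DM by blast
    have "\<exists>N. \<forall>m\<ge>N. \<forall>n\<ge>N. dms_dist (D m) (D n) < ennreal r" if "r > 0" for r
    proof -
      obtain N where "\<And>m n. N \<le> m \<Longrightarrow> N \<le> n \<Longrightarrow> ?d (D m) (D n) < r"
        using MC \<open>r > 0\<close> unfolding MCauchy_def by blast
      then show ?thesis
        using enn2real_dms_dist_less_iff[OF fin_D \<open>r > 0\<close>] by blast
    qed
    then obtain E where E:
      "\<And>r. r > 0 \<Longrightarrow> \<forall>\<^sub>F n in sequentially. dms_dist (D n) E < ennreal r"
      using dms_Cauchy_converges[of D] by metis
    have "almost_periodic E"
    proof (rule almost_periodic_limit)
      fix r :: real
      assume "r > 0"
      then obtain n where "dms_dist (D n) E < ennreal r"
        using E[of r] by (auto simp: eventually_sequentially)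
      then have "almost_periodic (D n) \<and> dms_dist E (D n) < ennreal r"
        using DM[of n] by (simp add: dms_dist_commute)
      then show "\<exists>F. almost_periodic F \<and> dms_dist E F < ennreal r"
        by blast
    qed
    moreover have "dms_dist E D\<^sub>0 < \<infinity>"
    proof -
      obtain n where "dms_dist (D n) E < ennreal 1"
        using E[of 1] by (auto simp: eventually_sequentially)
      also have "ennreal 1 < \<infinity>"
        by simp
      finally show ?thesis
        using finite_trans[of E "D n" D\<^sub>0] DM[of n] by (simp add: dms_dist_commute)
    qed
    ultimately have EM: "E \<in> ?M"
      by simp
    have "\<forall>\<^sub>F n in sequentially. D n \<in> ?M \<and> ?d (D n) E < r" if "r > 0" for r
      using E[OF that]
    proof eventually_elim
      case (elim n)
      moreover have "dms_dist (D n) E < \<infinity>"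
        using fin DM EM by blast
      ultimately show ?case
        using DM that by (simp add: enn2real_dms_dist_less_iff)
    qed
    then show "\<exists>E. limitin mtopology D E sequentially"
      using EM unfolding limitin_metric by blast
  qed
qed

end
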